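(* Let $k$ be a field of characteristic $0$, $n\ge3$, $S=k[x_1,\dots,x_n]$, and let $(a_0:a_1:a_2)\in\mathbb P^2$. The Hilbert function of $S/\operatorname{ann}(a_0p_1^3+a_1np_1p_2+a_2n^2p_3)$ is \[ \begin{cases} (1,1,1,1)&\text{at }\mathcal P=(1:0:0),\\ (1,n-1,n-1,1)&\text{at }\mathcal Q=(2:-3:1),\\ (1,n,n,1)&\text{otherwise.} \end{cases} \]
   Context: $p_i=\sum_{j=1}^nX_j^i\in k[X_1,\dots,X_n]$. $S$ acts on $k[X_1,\dots,X_n]$ with $x_i$ acting as $\partial/\partial X_i$, and $\operatorname{ann}(F)\subseteq S$ is the annihilator of $F$. The Hilbert function is listed as $(\dim_k A_0,\dim_kA_1,\dim_kA_2,\dim_kA_3)$ for $A=S/\operatorname{ann}(F)$; $A_i=0$ for $i>3$. "At $(a_0:a_1:a_2)$" refers to the coefficient point of the cubic. *)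

theory Defs
  imports
    "HOL-Library.Poly_Mapping"
    "HOL-Library.More_List"
    "HOL-Library.Cardinality"
    "HOL-Algebra.Embedded_Algebras"
    "HOL-Algebra.QuotRing"
    "HOL-Algebra.Algebraic_Closure_Type"
begin

text \<open>
  For a finite index type \<open>'n\<close> with \<open>n = CARD('n)\<close>, the type below is the polynomial ring in \<open>n\<close>
  variables over \<open>'k\<close>: a polynomial is the finitely supported map sending an exponent vector to
  its coefficient.  It serves both as \<open>k[X\<^sub>1,\<dots>,X\<^sub>n]\<close> and as the ring \<open>S\<close> acting on it.
\<close>

type_synonym ('n, 'k) mpoly = "('n \<Rightarrow>\<^sub>0 nat) \<Rightarrow>\<^sub>0 'k"

definition const :: "'k::zero \<Rightarrow> ('n, 'k) mpoly" where
  "const c = Poly_Mapping.single 0 c"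

definition var :: "'n \<Rightarrow> ('n, 'k::zero_neq_one) mpoly" where
  "var i = Poly_Mapping.single (Poly_Mapping.single i 1) 1"

definition power_sum :: "nat \<Rightarrow> ('n::finite, 'k::comm_semiring_1) mpoly" where
  "power_sum d = (\<Sum>j\<in>UNIV. var j ^ d)"


subsection \<open>The action by differentiation\<close>

text \<open>The term \<open>c X\<^sup>\<beta>\<close> contributes \<open>\<beta>\<^sub>i c X\<^bsup>\<beta>-e\<^sub>i\<^esup>\<close>; if \<open>\<beta>\<^sub>i = 0\<close>, the truncated difference is
  harmless because the coefficient vanishes.\<close>

definition partial_deriv :: "'n \<Rightarrow> ('n, 'k::comm_semiring_1) mpoly \<Rightarrow> ('n, 'k) mpoly" where
  "partial_deriv i F =
     (\<Sum>\<beta>\<in>Poly_Mapping.keys F.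
        Poly_Mapping.single (\<beta> - Poly_Mapping.single i 1)
          (of_nat (Poly_Mapping.lookup \<beta> i) * Poly_Mapping.lookup F \<beta>))"

text \<open>The monomial \<open>x\<^sup>\<alpha>\<close> acts by applying \<open>\<partial>/\<partial>X\<^sub>i\<close> exactly \<open>\<alpha>\<^sub>i\<close> times for every \<open>i\<close>; the order is
  irrelevant, see \<open>partial_deriv_commute\<close> below.\<close>

definition monom_act :: "('n::finite \<Rightarrow>\<^sub>0 nat) \<Rightarrow> ('n, 'k::comm_semiring_1) mpoly \<Rightarrow> ('n, 'k) mpoly" where
  "monom_act \<alpha> F =
     Finite_Set.fold (\<lambda>i. partial_deriv i ^^ Poly_Mapping.lookup \<alpha> i) F UNIV"

definition act :: "('n::finite, 'k::comm_semiring_1) mpoly \<Rightarrow> ('n, 'k) mpoly \<Rightarrow> ('n, 'k) mpoly" where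
  "act f F = (\<Sum>\<alpha>\<in>Poly_Mapping.keys f. const (Poly_Mapping.lookup f \<alpha>) * monom_act \<alpha> F)"

definition ann :: "('n::finite, 'k::comm_semiring_1) mpoly \<Rightarrow> ('n, 'k) mpoly set" where
  "ann F = {f. act f F = 0}"


subsection \<open>The graded algebra and its Hilbert function\<close>

definition homogeneous_part :: "nat \<Rightarrow> ('n::finite, 'k::zero) mpoly set" where
  "homogeneous_part d =
     {f. \<forall>\<alpha>\<in>Poly_Mapping.keys f. (\<Sum>i\<in>UNIV. Poly_Mapping.lookup \<alpha> i) = d}"

definition apolar_algebra :: "('n::finite, 'k::comm_ring_1) mpoly \<Rightarrow> ('n, 'k) mpoly set ring" where
  "apolar_algebra F = ring_of_type_algebra Quot ann F"

definition residue_class :: "('n::finite, 'k::comm_ring_1) mpoly \<Rightarrow> ('n, 'k) mpoly \<Rightarrow> ('n, 'k) mpoly set" where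
  "residue_class F f = ann F +>\<^bsub>ring_of_type_algebra\<^esub> f"

text \<open>The base field, embedded in the quotient, is the image of the constants, and \<open>A\<^sub>d\<close> is the
  image of the forms of degree \<open>d\<close>.\<close>

definition hilbert_function :: "('n::finite, 'k::field) mpoly \<Rightarrow> nat \<Rightarrow> nat" where
  "hilbert_function F d =
     ring.dim (apolar_algebra F)
       (residue_class F ` range const) (residue_class F ` homogeneous_part d)"


subsection \<open>The family of cubics and its parameter space\<close>

definition symmetric_cubic :: "'k \<Rightarrow> 'k \<Rightarrow> 'k \<Rightarrow> ('n::finite, 'k::comm_semiring_1) mpoly" where
  "symmetric_cubic a0 a1 a2 =
     const a0 * power_sum 1 ^ 3
     + const (a1 * of_nat CARD('n)) * power_sum 1 * power_sum 2
     + const (a2 * of_nat CARD('n) ^ 2) * power_sum 3"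

text \<open>For \<open>(a\<^sub>0, a\<^sub>1, a\<^sub>2) \<noteq> 0\<close> this is the point \<open>(a\<^sub>0 : a\<^sub>1 : a\<^sub>2)\<close> of the projective plane, as the
  set of its representatives.\<close>

definition proj_point :: "'k::field \<Rightarrow> 'k \<Rightarrow> 'k \<Rightarrow> ('k \<times> 'k \<times> 'k) set" where
  "proj_point a0 a1 a2 = {(c * a0, c * a1, c * a2) | c. c \<noteq> 0}"


subsection \<open>Well-definedness\<close>

lemma lookup_partial_deriv:
  "Poly_Mapping.lookup (partial_deriv i F) \<gamma> =
     of_nat (Suc (Poly_Mapping.lookup \<gamma> i)) * Poly_Mapping.lookup F (\<gamma> + Poly_Mapping.single i 1)"
proof -
  let ?e = "Poly_Mapping.single i (1::nat)"
  have *: "\<beta> - ?e = \<gamma> \<longleftrightarrow> \<beta> = \<gamma> + ?e" if "Poly_Mapping.lookup \<beta> i \<noteq> 0" for \<beta>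
  proof
    assume "\<beta> - ?e = \<gamma>"
    then show "\<beta> = \<gamma> + ?e"
      using that by (intro poly_mapping_eqI)
        (auto simp: lookup_add lookup_minus lookup_single when_def)
  qed simp
  have "Poly_Mapping.lookup (partial_deriv i F) \<gamma> =
     (\<Sum>\<beta>\<in>Poly_Mapping.keys F.
        if \<beta> = \<gamma> + ?e then of_nat (Poly_Mapping.lookup \<beta> i) * Poly_Mapping.lookup F \<beta> else 0)"
    unfolding partial_deriv_def lookup_sum
  proof (rule sum.cong)
    fix \<beta>
    show "Poly_Mapping.lookup (Poly_Mapping.single (\<beta> - ?e)
        (of_nat (Poly_Mapping.lookup \<beta> i) * Poly_Mapping.lookup F \<beta>)) \<gamma> =
      (if \<beta> = \<gamma> + ?e then of_nat (Poly_Mapping.lookup \<beta> i) * Poly_Mapping.lookup F \<beta> else 0)"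
      using *[of \<beta>] by (cases "Poly_Mapping.lookup \<beta> i = 0")
        (auto simp: lookup_single when_def lookup_add)
  qed simp
  then show ?thesis
    by (auto simp: lookup_add in_keys_iff)
qed

lemma partial_deriv_commute:
  "partial_deriv i (partial_deriv j F) = partial_deriv j (partial_deriv i F)"
proof (cases "i = j")
  case False
  then show ?thesis
    by (intro poly_mapping_eqI)
      (simp add: lookup_partial_deriv lookup_add lookup_single add.commute add.left_commute mult.left_commute)
qed simp

lemma partial_deriv_add: "partial_deriv i (F + G) = partial_deriv i F + partial_deriv i G"
  by (intro poly_mapping_eqI) (simp add: lookup_partial_deriv lookup_add distrib_left)

lemma lookup_const_mult:
  "Poly_Mapping.lookup (const c * F) \<gamma> = (c :: 'k::comm_semiring_1) * Poly_Mapping.lookup F \<gamma>"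
  unfolding const_def mult_map_scale_conv_mult[symmetric] 
  by (simp add: Poly_Mapping.map.rep_eq when_def)

lemma partial_deriv_const_mult: "partial_deriv i (const c * F) = const c * partial_deriv i F"
  by (intro poly_mapping_eqI) (simp add: lookup_partial_deriv lookup_const_mult mult.left_commute)

lemma partial_deriv_funpow_commute:
  "(partial_deriv i ^^ a) ((partial_deriv j ^^ b) F) = (partial_deriv j ^^ b) ((partial_deriv i ^^ a) F)"
proof -
  have 1: "partial_deriv i ((partial_deriv j ^^ b) F) = (partial_deriv j ^^ b) (partial_deriv i F)" for F
    by (induction b) (auto simp: partial_deriv_commute[of i])
  show ?thesis
    by (induction a) (auto simp: 1)
qed

interpretation monom_act: comp_fun_commute "\<lambda>i. partial_deriv i ^^ Poly_Mapping.lookup \<alpha> i" for \<alpha>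
  by standard (auto simp: fun_eq_iff partial_deriv_funpow_commute)

lemma monom_act_zero: "monom_act 0 F = F"
proof -
  have "Finite_Set.fold (\<lambda>i. partial_deriv i ^^ Poly_Mapping.lookup 0 i) F A = F"
    if "finite A" for A
    using that
  proof (induction A)
    case (insert x A)
    show ?case
      unfolding monom_act.fold_insert[OF insert(1,2)] insert.IH
      by simp
  qed simp
  then show ?thesis by (simp add: monom_act_def)
qed

lemma fold_partial_deriv_commute:
  assumes "finite A"
  shows "Finite_Set.fold (\<lambda>i. partial_deriv i ^^ Poly_Mapping.lookup \<alpha> i) ((partial_deriv j ^^ b) F) A =
    (partial_deriv j ^^ b) (Finite_Set.fold (\<lambda>i. partial_deriv i ^^ Poly_Mapping.lookup \<alpha> i) F A)"
  using assms by (induction A) (auto simp: partial_deriv_funpow_commute)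

lemma monom_act_add: "monom_act (\<alpha> + \<beta>) F = monom_act \<alpha> (monom_act \<beta> F)"
proof -
  have "Finite_Set.fold (\<lambda>i. partial_deriv i ^^ Poly_Mapping.lookup (\<alpha> + \<beta>) i) F A =
    Finite_Set.fold (\<lambda>i. partial_deriv i ^^ Poly_Mapping.lookup \<alpha> i)
      (Finite_Set.fold (\<lambda>i. partial_deriv i ^^ Poly_Mapping.lookup \<beta> i) F A) A"
    if "finite A" for A
    using that
  proof (induction A)
    case (insert x A)
    show ?case
      unfolding monom_act.fold_insert[OF insert(1,2)] insert.IH
      by (simp add: lookup_add funpow_add fold_partial_deriv_commute[OF insert(1)])
  qed simp
  then show ?thesis by (simp add: monom_act_def)
qed

lemma monom_act_single: "monom_act (Poly_Mapping.single i a) F = (partial_deriv i ^^ a) F"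
proof -
  have "Finite_Set.fold (\<lambda>j. partial_deriv j ^^ Poly_Mapping.lookup (Poly_Mapping.single i a) j) F A =
     (if i \<in> A then (partial_deriv i ^^ a) F else F)" if "finite A" for A
    using that
  proof (induction A)
    case (insert x A)
    show ?case
      unfolding monom_act.fold_insert[OF insert(1,2)] insert.IH
      using insert(2) by (auto simp: lookup_single when_def)
  qed simp
  then show ?thesis by (simp add: monom_act_def)
qed

lemma const_zero [simp]: "const 0 = 0"
  by (simp add: const_def)

lemma const_one [simp]: "const 1 = 1"
  by (simp add: const_def)

lemma const_add: "const (a + b) = const a + const b"
  by (simp add: const_def single_add)

lemma const_mult: "const (a * b) = const a * const b"
  by (simp add: const_def mult_single)

lemma monom_act_plus_right: "monom_act \<alpha> (F + G) = monom_act \<alpha> F + monom_act \<alpha> G"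
proof -
  have 1: "(partial_deriv i ^^ a) (F + G) = (partial_deriv i ^^ a) F + (partial_deriv i ^^ a) G" for i a F G
    by (induction a) (auto simp: partial_deriv_add)
  have "Finite_Set.fold (\<lambda>i. partial_deriv i ^^ Poly_Mapping.lookup \<alpha> i) (F + G) A =
    Finite_Set.fold (\<lambda>i. partial_deriv i ^^ Poly_Mapping.lookup \<alpha> i) F A +
    Finite_Set.fold (\<lambda>i. partial_deriv i ^^ Poly_Mapping.lookup \<alpha> i) G A" if "finite A" for A
    using that by (induction A) (auto simp: 1)
  then show ?thesis by (simp add: monom_act_def)
qed

lemma monom_act_const_mult: "monom_act \<alpha> (const c * F) = const c * monom_act \<alpha> F"
proof -
  have 1: "(partial_deriv i ^^ a) (const c * F) = const c * (partial_deriv i ^^ a) F" for i a F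
    by (induction a) (auto simp: partial_deriv_const_mult)
  have "Finite_Set.fold (\<lambda>i. partial_deriv i ^^ Poly_Mapping.lookup \<alpha> i) (const c * F) A =
    const c * Finite_Set.fold (\<lambda>i. partial_deriv i ^^ Poly_Mapping.lookup \<alpha> i) F A" if "finite A" for A
    using that by (induction A) (auto simp: 1)
  then show ?thesis by (simp add: monom_act_def)
qed

lemma act_superset:
  assumes "finite A" "Poly_Mapping.keys f \<subseteq> A"
  shows "act f F = (\<Sum>\<alpha>\<in>A. const (Poly_Mapping.lookup f \<alpha>) * monom_act \<alpha> F)"
  unfolding act_def using assms by (intro sum.mono_neutral_left) (auto simp: in_keys_iff)

lemma act_zero [simp]: "act 0 F = 0"
  by (simp add: act_def)

lemma act_single: "act (Poly_Mapping.single \<alpha> c) F = const c * monom_act \<alpha> F"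
  by (subst act_superset[of "{\<alpha>}"]) auto

lemma act_add: "act (f + g) F = act f F + act g F"
proof -
  let ?A = "Poly_Mapping.keys f \<union> Poly_Mapping.keys g"
  have "act (f + g) F = (\<Sum>\<alpha>\<in>?A. const (Poly_Mapping.lookup (f + g) \<alpha>) * monom_act \<alpha> F)"
    by (rule act_superset) (use Poly_Mapping.keys_add[of f g] in auto)
  also have "\<dots> = act f F + act g F"
    by (simp add: act_superset[of ?A f] act_superset[of ?A g] lookup_add const_add distrib_right sum.distrib)
  finally show ?thesis .
qed

lemma act_add_right: "act f (F + G) = act f F + act f G"
  by (simp add: act_def monom_act_plus_right distrib_left sum.distrib)

lemma mpoly_induct [case_names single add]:
  assumes single: "\<And>\<alpha> c. P (Poly_Mapping.single \<alpha> c)"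
    and add: "\<And>f g. P f \<Longrightarrow> P g \<Longrightarrow> P (f + g)"
  shows "P (f :: ('n, 'k::comm_monoid_add) mpoly)"
proof -
  have "P (\<Sum>\<alpha>\<in>A. Poly_Mapping.single \<alpha> (Poly_Mapping.lookup f \<alpha>))" if "finite A" for A
    using that
  proof (induction A)
    case empty
    show ?case using single[of 0 0] by simp
  qed (auto intro: assms)
  moreover have "(\<Sum>\<alpha>\<in>Poly_Mapping.keys f. Poly_Mapping.single \<alpha> (Poly_Mapping.lookup f \<alpha>)) = f"
    by (intro poly_mapping_eqI)
      (auto simp: lookup_sum lookup_single when_def in_keys_iff)
  ultimately show ?thesis by (metis finite_keys)
qed

lemma act_const_mult_right: "act f (const c * F) = const c * act f F"
  by (simp add: act_def monom_act_const_mult sum_distrib_left mult.left_commute)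

lemma act_one: "act 1 F = F"
  using act_single[of 0 1 F] by (simp add: monom_act_zero)

theorem act_var: "act (var i) F = partial_deriv i F"
  by (simp add: var_def act_single monom_act_single)

theorem act_mult: "act (f * g) F = act f (act g F)"
proof (induction f rule: mpoly_induct)
  case (single \<alpha> c)
  show ?case
  proof (induction g rule: mpoly_induct)
    case (single \<beta> d)
    then show ?case
      by (simp add: mult_single act_single monom_act_add monom_act_const_mult const_mult mult.assoc)
  qed (simp add: distrib_left act_add act_add_right)
qed (simp add: distrib_right act_add)

lemma act_zero_right [simp]: "act f 0 = 0"
  using act_const_mult_right[of f 0 0] by simp

lemma act_uminus: "act (- f) F = - act (f :: ('n::finite, 'k::comm_ring_1) mpoly) F"
  using act_add[of "- f" f F] by (simp add: eq_neg_iff_add_eq_0)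

theorem ideal_ann:
  "ideal (ann F) (ring_of_type_algebra :: ('n::finite, 'k::comm_ring_1) mpoly ring)"
proof -
  let ?S = "ring_of_type_algebra :: ('n, 'k) mpoly ring"
  interpret S: cring ?S by (rule cring_from_type_algebra)
  have inv: "m_inv (add_monoid ?S) x = - x" for x
    using S.add.inv_equality[of "- x" x] by (simp add: a_inv_def ring_of_type_algebra_def)
  show ?thesis
  proof (rule idealI)
    show "ring ?S" by (rule S.ring_axioms)
    show "subgroup (ann F) (add_monoid ?S)"
      by (rule S.add.subgroupI)
        (use inv in \<open>auto simp: ann_def act_add act_uminus a_inv_def ring_of_type_algebra_def intro: exI[of _ 0]\<close>)
  next
    fix a x assume "a \<in> ann F" "x \<in> carrier ?S"
    then have "act a F = 0" by (simp add: ann_def)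
    then have "act (x * a) F = 0" by (simp add: act_mult)
    then show "x \<otimes>\<^bsub>?S\<^esub> a \<in> ann F" "a \<otimes>\<^bsub>?S\<^esub> x \<in> ann F"
      by (simp_all add: ann_def ring_of_type_algebra_def mult.commute)
  qed
qed

end

theory Submission
  imports Defs
begin

text \<open>
  The map \<open>f \<mapsto> act f F\<close> identifies \<open>A\<^sub>d\<close> with the span of the \<open>d\<close>-th order partial derivatives of \<open>F\<close>.
  With \<open>\<partial>\<^sub>i\<close> for \<open>\<partial>/\<partial>X\<^sub>i\<close>, the second derivatives of the cubic are
  \<open>\<partial>\<^sub>i\<partial>\<^sub>j F = 6 a\<^sub>0 p\<^sub>1 + 2 a\<^sub>1 n (X\<^sub>i + X\<^sub>j) + [i = j] (2 a\<^sub>1 n p\<^sub>1 + 6 a\<^sub>2 n\<^sup>2 X\<^sub>i)\<close>.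
  Away from \<open>\<P>\<close>, a linear relation among the \<open>\<partial>\<^sub>i F\<close> must have all its coefficients equal, because
  \<open>n \<ge> 3\<close> leaves a third index to compare any two of them, and
  \<open>\<Sum>\<^sub>i \<partial>\<^sub>i F = n (3 a\<^sub>0 + 2 a\<^sub>1) p\<^sub>1\<^sup>2 + n\<^sup>2 (a\<^sub>1 + 3 a\<^sub>2) p\<^sub>2\<close> vanishes exactly at \<open>\<Q>\<close>.
  In degree 2 the second derivatives span all linear forms, except at \<open>\<Q>\<close>, where they span the
  forms \<open>n X\<^sub>i - p\<^sub>1\<close>, and at \<open>\<P>\<close>, where they are multiples of \<open>p\<^sub>1\<close>.
\<close>

section \<open>The apolar algebra as a space of derivatives\<close>

interpretation mpoly: vector_space "\<lambda>(c::'k::field) (f::('n, 'k) mpoly). const c * f"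
  by standard (simp_all add: distrib_left distrib_right const_add const_mult mult.assoc)

(* As a simp rule this would undo const_mult. *)
declare mpoly.scale_scale [simp del]

text \<open>Independence is wanted for indexed families, so that dimensions come out as
  cardinalities of index sets. Injectivity is part of it: two equal members would satisfy a relation
  with coefficients 1 and -1.\<close>

lemma (in vector_space) independent_family:
  assumes "finite I" and zero: "\<And>c i. (\<Sum>i\<in>I. scale (c i) (g i)) = 0 \<Longrightarrow> i \<in> I \<Longrightarrow> c i = 0"
  shows "inj_on g I" and "independent (g ` I)"
proof -
  show inj: "inj_on g I"
  proof (rule inj_onI, rule ccontr)
    fix x y assume xy: "x \<in> I" "y \<in> I" "g x = g y" "x \<noteq> y"
    define c where "c i = (if i = x then 1 else if i = y then - 1 else 0 :: 'a)" for i
    have "(\<Sum>i\<in>I. scale (c i) (g i)) = (\<Sum>i\<in>{x, y}. scale (c i) (g i))"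
      using assms(1) xy by (intro sum.mono_neutral_right) (auto simp: c_def)
    also have "\<dots> = 0" using xy by (simp add: c_def)
    finally have "c x = 0" using zero xy by blast
    then show False by (simp add: c_def)
  qed
  show "independent (g ` I)"
  proof (rule independent_if_scalars_zero)
    fix f v assume "(\<Sum>x\<in>g ` I. scale (f x) x) = 0" "v \<in> g ` I"
    then show "f v = 0"
      using zero[of "f \<circ> g"] by (auto simp: sum.reindex[OF inj])
  qed (use assms in simp)
qed

text \<open>The coset of \<open>ann F\<close> through \<open>f\<close> is the whole fibre of
  \<open>u \<mapsto> act u F\<close> over \<open>act f F\<close>, because \<open>act\<close> is
  additive in its first argument.\<close>

lemma residue_class_eq_iff:
  fixes F :: "('n::finite, 'k::comm_ring_1) mpoly"
  shows "residue_class F f = residue_class F g \<longleftrightarrow> act f F = act g F"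
proof -
  have "residue_class F f = {h + f | h. act h F = 0}" for f
    by (auto simp: residue_class_def a_r_coset_def' ring_of_type_algebra_def ann_def)
  also have "{h + f | h. act h F = 0} = {u. act u F = act f F}" for f
  proof (intro Collect_cong iffI)
    fix u assume "act u F = act f F"
    then have "act (u - f) F = 0"
      using act_add[of u "- f" F] by (simp add: act_uminus)
    then show "\<exists>h. u = h + f \<and> act h F = 0" by (intro exI[of _ "u - f"]) simp
  qed (auto simp: act_add)
  finally show ?thesis by auto
qed

lemma residue_class_ring_hom:
  "ring_hom_ring ring_of_type_algebra (apolar_algebra F) (residue_class F)"
  unfolding apolar_algebra_def residue_class_def[abs_def]
  by (rule ideal.rcos_ring_hom_ring[OF ideal_ann])

lemma const_ring_hom:
  "ring_hom_ring ring_of_type_algebra ring_of_type_algebra (const :: 'k::comm_ring_1 \<Rightarrow> ('n, 'k) mpoly)"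
  by (intro ring_hom_ringI2 ring_from_type_algebra ring_hom_memI)
    (auto simp: ring_of_type_algebra_def const_add const_mult)

lemma residue_class_hom_simps:
  fixes F :: "('n::finite, 'k::comm_ring_1) mpoly"
  shows "residue_class F f \<in> carrier (apolar_algebra F)"
    and "residue_class F (f + g) = residue_class F f \<oplus>\<^bsub>apolar_algebra F\<^esub> residue_class F g"
    and "residue_class F (f * g) = residue_class F f \<otimes>\<^bsub>apolar_algebra F\<^esub> residue_class F g"
    and "residue_class F 0 = \<zero>\<^bsub>apolar_algebra F\<^esub>"
    and "residue_class F 1 = \<one>\<^bsub>apolar_algebra F\<^esub>"
proof -
  interpret ring_hom_ring "ring_of_type_algebra :: ('n, 'k) mpoly ring" "apolar_algebra F" "residue_class F"
    by (rule residue_class_ring_hom)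
  show "residue_class F f \<in> carrier (apolar_algebra F)"
    and "residue_class F (f + g) = residue_class F f \<oplus>\<^bsub>apolar_algebra F\<^esub> residue_class F g"
    and "residue_class F (f * g) = residue_class F f \<otimes>\<^bsub>apolar_algebra F\<^esub> residue_class F g"
    and "residue_class F 0 = \<zero>\<^bsub>apolar_algebra F\<^esub>"
    and "residue_class F 1 = \<one>\<^bsub>apolar_algebra F\<^esub>"
    using hom_closed[of f] hom_add[of f g] hom_mult[of f g] hom_zero hom_one
    by (simp_all add: ring_of_type_algebra_def)
qed

text \<open>Since 1 acts as the identity, \<open>F \<noteq> 0\<close> keeps 1 out of
  \<open>ann F\<close>. The quotient is then nontrivial, and a ring homomorphism into it maps
  subfields to subfields.\<close>

lemma subfield_residue_class_const:
  fixes F :: "('n::finite, 'k::field) mpoly"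
  assumes "F \<noteq> 0"
  shows "subfield (residue_class F ` range const) (apolar_algebra F)"
proof -
  interpret K: field "ring_of_type_algebra :: 'k ring"
    by (rule field_from_type_algebra)
  interpret ring_hom_ring "ring_of_type_algebra :: ('n, 'k) mpoly ring" "apolar_algebra F" "residue_class F"
    by (rule residue_class_ring_hom)
  have nontrivial: "\<one>\<^bsub>apolar_algebra F\<^esub> \<noteq> \<zero>\<^bsub>apolar_algebra F\<^esub>"
    using assms residue_class_eq_iff[of F 1 0]
    by (simp add: residue_class_hom_simps(4,5)[symmetric] act_one)
  have "subfield (const ` carrier (ring_of_type_algebra :: 'k ring))
      (ring_of_type_algebra :: ('n, 'k) mpoly ring)"
    by (rule ring_hom_ring.img_is_subfield[OF const_ring_hom K.carrier_is_subfield])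
      (simp add: ring_of_type_algebra_def)
  then show ?thesis
    using img_is_subfield(2)[OF _ nontrivial] by (simp add: ring_of_type_algebra_def)
qed

lemma act_const: "act (const c) F = const c * F"
  by (simp add: const_def act_single[of 0] monom_act_zero)

text \<open>Links two notions of dimension: the inductive one for rings over a subfield, which grows
  by line extensions, and bases in the vector space of polynomials. Adding a basis vector
  \<open>act g F\<close> to \<open>B\<close> corresponds to extending by the class of
  \<open>g\<close>.\<close>

lemma dimension_residue_classes:
  fixes F :: "('n::finite, 'k::field) mpoly"
  assumes "finite B" "mpoly.independent B" "B \<subseteq> range (\<lambda>f. act f F)"
  shows "ring.dimension (apolar_algebra F) (card B) (residue_class F ` range const)
    (residue_class F ` {f. act f F \<in> mpoly.span B})"
proof -
  interpret hom: ring_hom_ring "ring_of_type_algebra :: ('n, 'k) mpoly ring" "apolar_algebra F" "residue_class F"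
    by (rule residue_class_ring_hom)
  show ?thesis
    using assms
  proof (induction B)
    case empty
    have "residue_class F ` {f. act f F = 0} = {\<zero>\<^bsub>apolar_algebra F\<^esub>}"
      using residue_class_eq_iff[of F _ 0] by (auto simp: residue_class_hom_simps(4) intro!: image_eqI[of _ _ 0])
    then show ?case by simp
  next
    case (insert b B)
    let ?E = "\<lambda>B. residue_class F ` {f. act f F \<in> mpoly.span B}"
    obtain g where g: "b = act g F" using insert.prems by auto
    have b: "b \<notin> mpoly.span B" and "mpoly.independent B"
      using insert.prems insert.hyps by (auto simp: mpoly.independent_insert)
    have notin: "residue_class F g \<notin> ?E B"
      using b g by (auto simp: residue_class_eq_iff)
    have "?E (insert b B) = hom.S.line_extension (residue_class F ` range const) (residue_class F g) (?E B)"
      (is "?L = ?R")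
    proof (intro subset_antisym subsetI)
      fix u assume "u \<in> ?L"
      then obtain f c where f: "u = residue_class F f" "act f F - const c * b \<in> mpoly.span B"
        by (auto simp: mpoly.span_breakdown_eq)
      have "act (f - const c * g) F = act f F - const c * b"
        using act_add[of f "- (const c * g)" F] by (simp add: act_uminus act_mult act_const g)
      then have "residue_class F (f - const c * g) \<in> ?E B" using f by simp
      moreover have "u = residue_class F (const c * g + (f - const c * g))" using f by simp
      ultimately show "u \<in> ?R"
        unfolding hom.S.line_extension_mem_iff residue_class_hom_simps(2,3) by blast
    next
      fix u assume "u \<in> ?R"
      then obtain c f where "u = residue_class F (const c * g + f)" "act f F \<in> mpoly.span B"
        by (auto simp: hom.S.line_extension_mem_iff residue_class_hom_simps(2,3))
      moreover have "act (const c * g + f) F - const c * b = act f F"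
        by (simp add: act_add act_mult act_const g)
      ultimately show "u \<in> ?L"
        unfolding mpoly.span_breakdown_eq by (intro image_eqI[of _ _ "const c * g + f"]) (auto intro: exI[of _ c])
    qed
    then show ?case
      using hom.S.dimension.Suc_dim[OF residue_class_hom_simps(1) notin insert.IH] insert
        \<open>mpoly.independent B\<close> by simp
  qed
qed

section \<open>Iterated derivatives and the graded pieces of the apolar algebra\<close>

primrec derivatives :: "nat \<Rightarrow> ('n, 'k::comm_semiring_1) mpoly \<Rightarrow> ('n, 'k) mpoly set" where
  "derivatives 0 F = {F}"
| "derivatives (Suc d) F = {partial_deriv i G | i G. G \<in> derivatives d F}"

text \<open>An exponent vector of degree \<open>Suc d\<close> is a unit vector plus one of degree
  \<open>d\<close>, and \<open>monom_act\<close> turns sums of exponents into composition.\<close>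

lemma derivatives_eq_monom_act:
  "derivatives d F = {monom_act \<alpha> F | \<alpha>. (\<Sum>i\<in>UNIV. Poly_Mapping.lookup \<alpha> i) = d}"
proof (induction d)
  case 0
  have "(\<Sum>i\<in>UNIV. Poly_Mapping.lookup \<alpha> i) = 0 \<longleftrightarrow> \<alpha> = 0" for \<alpha> :: "'a \<Rightarrow>\<^sub>0 nat"
    by (auto simp: poly_mapping_eq_iff fun_eq_iff)
  then show ?case by (auto simp: monom_act_zero)
next
  case (Suc d)
  have "(\<Sum>i\<in>UNIV. Poly_Mapping.lookup \<alpha> i) = Suc d \<longleftrightarrow>
      (\<exists>i \<beta>. \<alpha> = Poly_Mapping.single i 1 + \<beta> \<and> (\<Sum>i\<in>UNIV. Poly_Mapping.lookup \<beta> i) = d)"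
    (is "?l \<longleftrightarrow> ?r") for \<alpha> :: "'a \<Rightarrow>\<^sub>0 nat"
  proof
    assume l: ?l
    then obtain i where i: "Poly_Mapping.lookup \<alpha> i \<noteq> 0"
      by (metis Zero_not_Suc sum.neutral)
    define \<beta> where "\<beta> = \<alpha> - Poly_Mapping.single i 1"
    have *: "\<alpha> = Poly_Mapping.single i 1 + \<beta>"
      using i by (intro poly_mapping_eqI) (auto simp: \<beta>_def lookup_add lookup_minus lookup_single when_def)
    have "(\<Sum>i\<in>UNIV. Poly_Mapping.lookup \<beta> i) = d"
      using l unfolding * by (simp add: lookup_add sum.distrib lookup_single when_def)
    with * show ?r by blast
  qed (auto simp: lookup_add sum.distrib lookup_single when_def)
  then show ?case
    by (force simp: Suc.IH monom_act_add monom_act_single)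
qed

lemma act_image_homogeneous_part:
  fixes F :: "('n::finite, 'k::field) mpoly"
  shows "(\<lambda>f. act f F) ` homogeneous_part d = mpoly.span (derivatives d F)"
proof (intro subset_antisym subsetI)
  fix u assume "u \<in> (\<lambda>f. act f F) ` homogeneous_part d"
  then show "u \<in> mpoly.span (derivatives d F)"
    by (auto simp: act_def homogeneous_part_def derivatives_eq_monom_act
        intro!: mpoly.span_sum mpoly.span_scale[OF mpoly.span_base])
next
  fix u assume "u \<in> mpoly.span (derivatives d F)"
  then show "u \<in> (\<lambda>f. act f F) ` homogeneous_part d"
  proof (induction rule: mpoly.span_induct_alt)
    case base
    then show ?case by (intro image_eqI[of _ _ 0]) (auto simp: homogeneous_part_def)
  next
    case (step c x y)
    then obtain \<alpha> f where "x = monom_act \<alpha> F" "y = act f F" "f \<in> homogeneous_part d"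
      "(\<Sum>i\<in>UNIV. Poly_Mapping.lookup \<alpha> i) = d"
      by (auto simp: derivatives_eq_monom_act)
    then show ?case
      using Poly_Mapping.keys_add[of "Poly_Mapping.single \<alpha> c" f]
      by (intro image_eqI[of _ _ "Poly_Mapping.single \<alpha> c + f"])
        (auto simp: act_add act_single homogeneous_part_def split: if_splits)
  qed
qed

text \<open>Reduces every value of the Hilbert function to linear algebra on polynomials: it
  suffices to find an independent family with the same span as the \<open>d\<close>-th derivatives.
  The quotient ring does not appear again after this.\<close>

theorem hilbert_function_eq_card:
  fixes F :: "('n::finite, 'k::field) mpoly"
  assumes "F \<noteq> 0" "finite I" and span: "mpoly.span (derivatives d F) = mpoly.span (g ` I)"
    and zero: "\<And>c i. (\<Sum>i\<in>I. const (c i) * g i) = 0 \<Longrightarrow> i \<in> I \<Longrightarrow> c i = 0"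
  shows "hilbert_function F d = card I"
proof -
  interpret hom: ring_hom_ring "ring_of_type_algebra :: ('n, 'k) mpoly ring" "apolar_algebra F" "residue_class F"
    by (rule residue_class_ring_hom)
  have indep: "inj_on g I" "mpoly.independent (g ` I)"
    by (rule mpoly.independent_family; use assms in blast)+
  have image: "(\<lambda>f. act f F) ` homogeneous_part d = mpoly.span (g ` I)"
    by (simp add: act_image_homogeneous_part span)
  have "residue_class F ` homogeneous_part d = residue_class F ` {f. act f F \<in> mpoly.span (g ` I)}"
  proof (intro subset_antisym subsetI)
    fix u assume "u \<in> residue_class F ` {f. act f F \<in> mpoly.span (g ` I)}"
    then obtain f where f: "u = residue_class F f" "act f F \<in> mpoly.span (g ` I)" by auto
    then obtain h where "act f F = act h F" "h \<in> homogeneous_part d" using image by force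
    then show "u \<in> residue_class F ` homogeneous_part d"
      using f by (auto simp: residue_class_eq_iff intro!: image_eqI[of _ _ h])
  qed (use image in auto)
  moreover have "g ` I \<subseteq> range (\<lambda>f. act f F)"
    using image mpoly.span_superset[of "g ` I"] by blast
  ultimately have "hom.S.dimension (card (g ` I)) (residue_class F ` range const)
      (residue_class F ` homogeneous_part d)"
    using dimension_residue_classes[of "g ` I" F] indep(2) assms(2) by simp
  from hom.S.dimI[OF subfield_residue_class_const[OF assms(1)] this] show ?thesis
    by (simp add: hilbert_function_def over_def card_image[OF indep(1)])
qed

text \<open>Each member is minus the sum of the others. At \<Q> this removes one generator in degree
  1 and one in degree 2.\<close>

lemma span_range_remove:
  fixes g :: "'i::finite \<Rightarrow> ('n, 'k::field) mpoly"
  assumes "(\<Sum>i\<in>UNIV. g i) = 0"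
  shows "mpoly.span (range g) = mpoly.span (g ` (UNIV - {i0}))"
proof -
  have "g i0 = - (\<Sum>i\<in>UNIV - {i0}. g i)"
    using assms by (simp add: sum.remove[of _ i0] eq_neg_iff_add_eq_0)
  then have "g i0 \<in> mpoly.span (g ` (UNIV - {i0}))"
    by (simp only:) (intro mpoly.span_neg mpoly.span_sum mpoly.span_base imageI)
  then have "mpoly.span (insert (g i0) (g ` (UNIV - {i0}))) = mpoly.span (g ` (UNIV - {i0}))"
    by (rule mpoly.span_redundant)
  moreover have "insert (g i0) (g ` (UNIV - {i0})) = range g" by auto
  ultimately show ?thesis by simp
qed

lemma hilbert_function_eq_1:
  fixes F :: "('n::finite, 'k::field) mpoly"
  assumes "F \<noteq> 0" "v \<noteq> 0" "mpoly.span (derivatives d F) = mpoly.span {v}"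
  shows "hilbert_function F d = 1"
  using hilbert_function_eq_card[of F "{()}" d "\<lambda>_. v"] assms
  by simp

lemma hilbert_function_eq_0:
  fixes F :: "('n::finite, 'k::field) mpoly"
  assumes "F \<noteq> 0" "derivatives d F \<subseteq> {0}"
  shows "hilbert_function F d = 0"
proof -
  have "mpoly.span (derivatives d F) \<subseteq> mpoly.span {0}"
    by (rule mpoly.span_mono) (use assms in simp)
  then have "mpoly.span (derivatives d F) = {0}"
    using mpoly.span_zero by auto
  then show ?thesis
    using hilbert_function_eq_card[of F "{} :: unit set" d "\<lambda>_. 0"] assms by simp
qed

section \<open>Calculus of polynomials\<close>

lemma const_numeral [simp]: "const (numeral m :: 'k::comm_semiring_1) = numeral m"
  by (simp add: const_def single_numeral)

lemma const_sum: "const (\<Sum>i\<in>A. f i) = (\<Sum>i\<in>A. const (f i))"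
  by (induction A rule: infinite_finite_induct) (simp_all add: const_add)

lemma const_eq_0_iff [simp]: "const c = 0 \<longleftrightarrow> c = 0"
  unfolding const_def by (metis lookup_single_eq lookup_zero single_zero)

lemma const_uminus: "const (- c :: 'k::comm_ring_1) = - const c"
  by (simp add: const_def single_uminus)

lemma const_diff: "const (c - d :: 'k::comm_ring_1) = const c - const d"
  by (simp add: const_def single_diff)

lemma const_of_nat: "const (of_nat m :: 'k::comm_semiring_1) = of_nat m"
  by (simp add: const_def single_of_nat)

lemma partial_deriv_single:
  "partial_deriv i (Poly_Mapping.single \<alpha> c) =
    Poly_Mapping.single (\<alpha> - Poly_Mapping.single i 1) (of_nat (Poly_Mapping.lookup \<alpha> i) * c)"
  by (simp add: partial_deriv_def)

lemma partial_deriv_zero [simp]: "partial_deriv i 0 = 0"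
  by (simp add: partial_deriv_def)

lemma derivatives_eq_0_mono:
  assumes "derivatives d F \<subseteq> {0}" "d \<le> e"
  shows "derivatives e F \<subseteq> {0}"
  using assms(2,1)
  by (induction e rule: dec_induct) auto

lemma partial_deriv_sum: "partial_deriv i (\<Sum>j\<in>A. f j) = (\<Sum>j\<in>A. partial_deriv i (f j))"
  by (induction A rule: infinite_finite_induct) (simp_all add: partial_deriv_add)

text \<open>Both sides are biadditive, so monomials suffice. There the truncated difference of
  exponents is the true one unless the exponent of variable \<open>i\<close> is 0, and in that case
  the coefficient vanishes.\<close>

lemma partial_deriv_mult:
  "partial_deriv i (F * G) = partial_deriv i F * G + F * partial_deriv i G"
proof (induction F rule: mpoly_induct)
  case (single \<alpha> c)
  show ?case
  proof (induction G rule: mpoly_induct)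
    case (single \<beta> d)
    have "\<alpha> + \<beta> - Poly_Mapping.single i 1 = \<alpha> - Poly_Mapping.single i 1 + \<beta>"
      if "Poly_Mapping.lookup \<alpha> i \<noteq> 0"
      using that by (intro poly_mapping_eqI) (auto simp: lookup_add lookup_minus lookup_single when_def)
    moreover have "\<alpha> + \<beta> - Poly_Mapping.single i 1 = \<alpha> + (\<beta> - Poly_Mapping.single i 1)"
      if "Poly_Mapping.lookup \<beta> i \<noteq> 0"
      using that by (intro poly_mapping_eqI) (auto simp: lookup_add lookup_minus lookup_single when_def)
    ultimately show ?case
      by (cases "Poly_Mapping.lookup \<alpha> i = 0"; cases "Poly_Mapping.lookup \<beta> i = 0")
        (simp_all add: partial_deriv_single mult_single lookup_add algebra_simps flip: single_add)
  qed (simp add: distrib_left partial_deriv_add algebra_simps)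
qed (simp add: distrib_right partial_deriv_add algebra_simps)

lemma partial_deriv_var: "partial_deriv i (var j) = (if i = j then 1 else 0)"
  by (auto simp: var_def partial_deriv_single lookup_single)

lemma partial_deriv_const [simp]: "partial_deriv i (const c) = 0"
  by (simp add: const_def partial_deriv_single)

lemma partial_deriv_one [simp]: "partial_deriv i 1 = 0"
  using partial_deriv_const[of i 1] by simp

lemma partial_deriv_numeral [simp]: "partial_deriv i (numeral m) = 0"
  using partial_deriv_const[of i "numeral m"] by simp

lemma partial_deriv_power:
  "partial_deriv i (F ^ m) = of_nat m * F ^ (m - 1) * partial_deriv i F"
proof (induction m)
  case (Suc m)
  then show ?case
    by (cases m) (simp_all add: partial_deriv_mult algebra_simps)
qed simp

lemma partial_deriv_power_sum:
  "partial_deriv i (power_sum m) = of_nat m * var i ^ (m - 1)"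
proof -
  have "partial_deriv i (power_sum m) = (\<Sum>j\<in>UNIV. if i = j then of_nat m * var j ^ (m - 1) else 0)"
    unfolding power_sum_def partial_deriv_sum
    by (intro sum.cong) (simp_all add: partial_deriv_power partial_deriv_var)
  then show ?thesis by simp
qed

lemma lookup_var: "Poly_Mapping.lookup (var i) (Poly_Mapping.single k 1) = (if i = k then 1 else 0)"
proof -
  have "Poly_Mapping.single i (1::nat) = Poly_Mapping.single k 1 \<longleftrightarrow> i = k"
    by (metis lookup_single_eq lookup_single_not_eq zero_neq_one)
  then show ?thesis by (simp add: var_def lookup_single when_def)
qed

text \<open>The coefficient of the sum at the \<open>i\<close>-th unit exponent vector is
  \<open>c i\<close>.\<close>

lemma var_independent:
  fixes c :: "'n::finite \<Rightarrow> 'k::comm_semiring_1"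
  assumes "(\<Sum>i\<in>UNIV. const (c i) * var i) = (0 :: ('n, 'k) mpoly)"
  shows "c i = 0"
proof -
  have "0 = Poly_Mapping.lookup (\<Sum>j\<in>UNIV. const (c j) * var j :: ('n, 'k) mpoly) (Poly_Mapping.single i 1)"
    using assms by simp
  also have "\<dots> = (\<Sum>j\<in>UNIV. if j = i then c j else 0)"
    unfolding lookup_sum lookup_const_mult lookup_var by (intro sum.cong) auto
  finally show ?thesis by simp
qed

lemma power_sum_1_in_span: "power_sum 1 \<in> mpoly.span (range var)"
  by (simp add: power_sum_def mpoly.span_sum mpoly.span_base)

lemma partial_deriv_symmetric_cubic:
  fixes a0 a1 a2 :: "'k::comm_semiring_1"
  defines "n \<equiv> of_nat CARD('n::finite)"
  shows "partial_deriv i (symmetric_cubic a0 a1 a2 :: ('n, 'k) mpoly) =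
    const (3 * a0) * power_sum 1 ^ 2
    + const (a1 * n) * (power_sum 2 + 2 * var i * power_sum 1)
    + const (3 * a2 * n ^ 2) * var i ^ 2"
  unfolding symmetric_cubic_def n_def
  by (simp add: partial_deriv_add partial_deriv_mult partial_deriv_power partial_deriv_power_sum
      const_mult algebra_simps)

lemma partial_deriv_2_symmetric_cubic:
  fixes a0 a1 a2 :: "'k::comm_semiring_1"
  defines "n \<equiv> of_nat CARD('n::finite)"
  shows "partial_deriv j (partial_deriv i (symmetric_cubic a0 a1 a2 :: ('n, 'k) mpoly)) =
    const (6 * a0) * power_sum 1 + const (2 * a1 * n) * (var i + var j)
    + (if i = j then const (2 * a1 * n) * power_sum 1 + const (6 * a2 * n ^ 2) * var i else 0)"
  unfolding partial_deriv_symmetric_cubic n_def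
  by (simp add: partial_deriv_add partial_deriv_mult partial_deriv_power partial_deriv_power_sum
      partial_deriv_var const_mult algebra_simps)

lemma partial_deriv_3_symmetric_cubic:
  fixes a0 a1 a2 :: "'k::comm_semiring_1"
  defines "n \<equiv> of_nat CARD('n::finite)"
  shows "partial_deriv k (partial_deriv j (partial_deriv i (symmetric_cubic a0 a1 a2 :: ('n, 'k) mpoly))) =
    const (6 * a0 + 2 * a1 * n * ((if i = k then 1 else 0) + (if j = k then 1 else 0))
      + (if i = j then 2 * a1 * n + 6 * a2 * n ^ 2 * (if i = k then 1 else 0) else 0))"
  unfolding partial_deriv_2_symmetric_cubic n_def
  by (simp add: partial_deriv_add partial_deriv_mult partial_deriv_power partial_deriv_power_sum
      partial_deriv_var const_mult const_add algebra_simps)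

section \<open>The family of cubics\<close>

locale cubic_family =
  fixes a0 a1 a2 :: "'k::field_char_0" and F :: "('n::finite, 'k) mpoly" and n :: 'k
  defines "F \<equiv> symmetric_cubic a0 a1 a2" and "n \<equiv> of_nat CARD('n)"
  assumes card: "CARD('n) \<ge> 3" and nonzero: "(a0, a1, a2) \<noteq> (0, 0, 0)"
begin

text \<open>Both use characteristic 0 and at least three variables. The factor \<open>n - 2\<close>
  arises at \<Q> in the second derivatives with equal indices.\<close>

lemma n_nonzero: "n \<noteq> 0" "n - 2 \<noteq> 0"
proof -
  show "n \<noteq> 0" using card by (simp add: n_def)
  have "n - 2 = of_nat (CARD('n) - 2)" using card by (simp add: n_def of_nat_diff)
  also have "\<dots> \<noteq> 0" unfolding of_nat_eq_0_iff using card by simp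
  finally show "n - 2 \<noteq> 0" .
qed

lemma third_index: obtains k :: 'n where "k \<noteq> i" "k \<noteq> j"
proof -
  have "card {i, j} \<le> 2" by (cases "i = j") simp_all
  then have "{i, j} \<noteq> UNIV" using card by (metis not_less_eq_eq eval_nat_numeral(3) le_trans)
  then show ?thesis using that by auto
qed

text \<open>This is the symmetric tensor of the cubic, in the shape that differentiation produces:
  \<open>6 * a0\<close> for distinct indices, \<open>6 * a0 + 2 * a1 * n\<close> if exactly two
  agree, and \<open>6 * (a0 + a1 * n + a2 * n ^ 2)\<close> if all agree.\<close>

definition third_deriv :: "'n \<Rightarrow> 'n \<Rightarrow> 'n \<Rightarrow> 'k" where
  "third_deriv i j k = 6 * a0 + 2 * a1 * n * ((if i = k then 1 else 0) + (if j = k then 1 else 0))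
      + (if i = j then 2 * a1 * n + 6 * a2 * n ^ 2 * (if i = k then 1 else 0) else 0)"

lemma deriv_1: "partial_deriv i F = const (3 * a0) * power_sum 1 ^ 2
    + const (a1 * n) * (power_sum 2 + 2 * var i * power_sum 1)
    + const (3 * a2 * n ^ 2) * var i ^ 2"
  unfolding F_def n_def by (rule partial_deriv_symmetric_cubic)

lemma deriv_2: "partial_deriv j (partial_deriv i F) =
    const (6 * a0) * power_sum 1 + const (2 * a1 * n) * (var i + var j)
    + (if i = j then const (2 * a1 * n) * power_sum 1 + const (6 * a2 * n ^ 2) * var i else 0)"
  unfolding F_def n_def by (rule partial_deriv_2_symmetric_cubic)

lemma deriv_3: "partial_deriv k (partial_deriv j (partial_deriv i F)) = const (third_deriv i j k)"
  unfolding F_def n_def third_deriv_def by (rule partial_deriv_3_symmetric_cubic)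

lemma derivatives_eq:
  "derivatives 1 F = range (\<lambda>i. partial_deriv i F)"
  "derivatives 2 F = {partial_deriv j (partial_deriv i F) | i j. True}"
  "derivatives 3 F = {const (third_deriv i j k) | i j k. True}"
  "derivatives 4 F = {0}"
  by (force simp: eval_nat_numeral deriv_3)+

text \<open>Three distinct, two equal and three equal indices give a triangular system for
  \<open>a0\<close>, \<open>a1\<close>, \<open>a2\<close> with nonzero diagonal.\<close>

lemma third_deriv_nonzero: obtains i j k where "third_deriv i j k \<noteq> 0"
proof (rule ccontr)
  assume "\<not> thesis"
  then have *: "third_deriv i j k = 0" for i j k using that by blast
  obtain i j k :: 'n where ijk: "j \<noteq> i" "k \<noteq> i" "k \<noteq> j" by (metis third_index)
  have "a0 = 0" using *[of i j k] ijk by (simp add: third_deriv_def)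
  moreover from this have "a1 = 0" using *[of i i k] ijk n_nonzero unfolding third_deriv_def by simp
  moreover from calculation have "a2 = 0"
    using *[of i i i] n_nonzero unfolding third_deriv_def by simp
  ultimately show False using nonzero by simp
qed

lemma F_nonzero: "F \<noteq> 0"
proof
  assume "F = 0"
  then have "third_deriv i j k = 0" for i j k using deriv_3[of k j i] by simp
  then show False using third_deriv_nonzero by blast
qed

lemma hilbert_0: "hilbert_function F 0 = 1"
  by (rule hilbert_function_eq_1[OF F_nonzero F_nonzero]) simp

lemma hilbert_3: "hilbert_function F 3 = 1"
proof (rule hilbert_function_eq_1[OF F_nonzero one_neq_zero])
  obtain i j k where ijk: "third_deriv i j k \<noteq> 0" by (rule third_deriv_nonzero)
  \<comment> \<open>The third derivatives are constants, so rescaling a nonzero one puts 1 into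
    their span.\<close>
  have "const (inverse (third_deriv i j k)) * const (third_deriv i j k) \<in> mpoly.span (derivatives 3 F)"
    unfolding derivatives_eq by (intro mpoly.span_scale mpoly.span_base) blast
  then have "1 \<in> mpoly.span (derivatives 3 F)"
    using ijk by (simp flip: const_mult)
  moreover have "const c \<in> mpoly.span {1}" for c
    using mpoly.span_scale[OF mpoly.span_base[of 1 "{1}"], of c] by simp
  ultimately show "mpoly.span (derivatives 3 F) = mpoly.span {1}"
    unfolding mpoly.span_eq by (auto simp: derivatives_eq)
qed

lemma hilbert_ge_4: "d \<ge> 4 \<Longrightarrow> hilbert_function F d = 0"
  by (rule hilbert_function_eq_0[OF F_nonzero]) (rule derivatives_eq_0_mono[of 4], simp_all add: derivatives_eq)

section \<open>Degree 1: linear relations among the first derivatives\<close>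

lemma first_deriv_relation:
  assumes "(\<Sum>i\<in>UNIV. const (c i) * partial_deriv i F) = 0"
  shows "6 * a0 * (\<Sum>i\<in>UNIV. c i) + 2 * a1 * n * (c j + c k)
    + (if j = k then 2 * a1 * n * (\<Sum>i\<in>UNIV. c i) + 6 * a2 * n ^ 2 * c j else 0) = 0"
proof -
  \<comment> \<open>The relation is between quadratic forms, so differentiating twice leaves one
    scalar equation for each pair \<open>j\<close>, \<open>k\<close>.\<close>
  have "0 = partial_deriv k (partial_deriv j (\<Sum>i\<in>UNIV. const (c i) * partial_deriv i F))"
    using assms by simp
  also have "\<dots> = const (\<Sum>i\<in>UNIV. c i * third_deriv i j k)"
    by (simp add: partial_deriv_sum partial_deriv_const_mult deriv_3 const_sum const_mult)
  finally have "0 = (\<Sum>i\<in>UNIV. c i * third_deriv i j k)" by simp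
  \<comment> \<open>Separate conditionals make every term that tests \<open>i\<close> collapse to a
    single summand; the rest are multiples of the sum of all \<open>c i\<close>.\<close>
  also have "\<dots> = (\<Sum>i\<in>UNIV. 6 * a0 * c i + (if i = k then 2 * a1 * n * c i else 0)
      + (if j = k then 2 * a1 * n * c i else 0) + (if i = j then 2 * a1 * n * c i else 0)
      + (if i = j then if j = k then 6 * a2 * n ^ 2 * c i else 0 else 0))"
    by (intro sum.cong refl) (auto simp: third_deriv_def algebra_simps)
  also have "\<dots> = 6 * a0 * (\<Sum>i\<in>UNIV. c i) + 2 * a1 * n * (c j + c k)
    + (if j = k then 2 * a1 * n * (\<Sum>i\<in>UNIV. c i) + 6 * a2 * n ^ 2 * c j else 0)"
    by (simp add: sum.distrib distrib_left add_ac flip: sum_distrib_left)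
  finally show ?thesis by simp
qed

text \<open>The equations for the pairs \<open>i\<close>, \<open>k\<close> and \<open>j\<close>,
  \<open>k\<close> differ by \<open>2 * a1 * n * (c i - c j)\<close>. If \<open>a1 = 0\<close>, the
  pairs \<open>i\<close>, \<open>k\<close> and \<open>i\<close>, \<open>i\<close> even force
  \<open>c i = 0\<close>.\<close>

lemma first_deriv_relation_const:
  assumes "a1 \<noteq> 0 \<or> a2 \<noteq> 0"
    and "(\<Sum>i\<in>UNIV. const (c i) * partial_deriv i F) = 0"
  shows "c i = c j"
proof (cases "a1 = 0")
  case False
  obtain k where k: "k \<noteq> i" "k \<noteq> j" by (rule third_index)
  have "2 * a1 * n * (c i + c k) = 2 * a1 * n * (c j + c k)"
    by (rule add_left_imp_eq[of "6 * a0 * (\<Sum>i\<in>UNIV. c i)"])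
      (use first_deriv_relation[OF assms(2), of i k] first_deriv_relation[OF assms(2), of j k] k in simp)
  then show ?thesis using False n_nonzero by simp
next
  case True
  have "c i = 0" for i
  proof -
    obtain k where "k \<noteq> i" by (rule third_index)
    then have "6 * a0 * (\<Sum>i\<in>UNIV. c i) = 0"
      using first_deriv_relation[OF assms(2), of i k] True by simp
    then have "6 * a2 * n ^ 2 * c i = 0"
      using first_deriv_relation[OF assms(2), of i i] True by (simp only:) simp
    then show ?thesis using True assms(1) n_nonzero by simp
  qed
  then show ?thesis by simp
qed

text \<open>With equal coefficients their sum is \<open>n * c i\<close>. The equation for two
  different indices then involves only \<open>3 * a0 + 2 * a1\<close>, and the one for equal indices
  adds a multiple of \<open>a1 + 3 * a2\<close>; \<Q> is where both vanish.\<close>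

lemma first_deriv_independent:
  assumes "a1 \<noteq> 0 \<or> a2 \<noteq> 0" and "3 * a0 + 2 * a1 \<noteq> 0 \<or> a1 + 3 * a2 \<noteq> 0"
    and rel: "(\<Sum>i\<in>UNIV. const (c i) * partial_deriv i F) = 0"
  shows "c i = 0"
proof -
  have c: "c j = c i" for j by (rule first_deriv_relation_const[OF assms(1) rel])
  have "(\<Sum>j\<in>UNIV. c j) = (\<Sum>j\<in>(UNIV :: 'n set). c i)" by (intro sum.cong refl c)
  then have s: "(\<Sum>j\<in>UNIV. c j) = n * c i" by (simp add: n_def)
  obtain k where k: "k \<noteq> i" by (rule third_index)
  have 1: "2 * n * c i * (3 * a0 + 2 * a1) = 0"
    using first_deriv_relation[OF rel, of i k] k by (simp add: s c[of k] algebra_simps)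
  have "2 * n * c i * (3 * a0 + 2 * a1) + 2 * n ^ 2 * c i * (a1 + 3 * a2) = 0"
    using first_deriv_relation[OF rel, of i i] by (simp add: s algebra_simps power2_eq_square)
  then have "2 * n ^ 2 * c i * (a1 + 3 * a2) = 0" using 1 by simp
  with 1 show ?thesis using assms(2) n_nonzero by auto
qed

text \<open>Supplies the relation with all coefficients 1 that holds at \<Q>, where both
  coefficients on the right are 0.\<close>

lemma sum_first_deriv:
  "(\<Sum>i\<in>UNIV. partial_deriv i F) =
    const (n * (3 * a0 + 2 * a1)) * power_sum 1 ^ 2 + const (n ^ 2 * (a1 + 3 * a2)) * power_sum 2"
proof -
  have n: "of_nat CARD('n) = (const n :: ('n, 'k) mpoly)"
    by (simp add: n_def const_of_nat)
  have "(\<Sum>i\<in>UNIV. partial_deriv i F) =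
      const n * (const (3 * a0) * power_sum 1 ^ 2 + const (a1 * n) * power_sum 2)
      + 2 * const (a1 * n) * power_sum 1 * (\<Sum>i\<in>UNIV. var i ^ 1)
      + const (3 * a2 * n ^ 2) * (\<Sum>i\<in>UNIV. var i ^ 2)"
    unfolding deriv_1 by (simp add: sum.distrib n sum_distrib_left sum_distrib_right algebra_simps)
  then show ?thesis
    unfolding power_sum_def[symmetric]
    by (simp add: const_mult const_add algebra_simps power2_eq_square)
qed

lemma hilbert_1_generic:
  assumes "a1 \<noteq> 0 \<or> a2 \<noteq> 0" and "3 * a0 + 2 * a1 \<noteq> 0 \<or> a1 + 3 * a2 \<noteq> 0"
  shows "hilbert_function F 1 = CARD('n)"
  by (rule hilbert_function_eq_card[OF F_nonzero])
    (use first_deriv_independent[OF assms] derivatives_eq(1) in auto)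

text \<open>If \<open>a1 = 0\<close>, the second derivatives at \<open>i\<close>, \<open>i\<close>
  and \<open>i\<close>, \<open>k\<close> differ by a nonzero multiple of \<open>var i\<close>.
  Otherwise all differences of variables lie in the span; modulo these \<open>power_sum 1\<close> is
  \<open>n\<close> times \<open>var i\<close>, and each second derivative is a multiple of
  \<open>var i\<close>. The two multiples obtained are governed by the same scalars as in degree
  1.\<close>

lemma hilbert_2_generic:
  assumes "a1 \<noteq> 0 \<or> a2 \<noteq> 0" and "3 * a0 + 2 * a1 \<noteq> 0 \<or> a1 + 3 * a2 \<noteq> 0"
  shows "hilbert_function F 2 = CARD('n)"
proof (rule hilbert_function_eq_card[OF F_nonzero finite])
  let ?V = "mpoly.span (derivatives 2 F)"
  have D: "partial_deriv j (partial_deriv i F) \<in> ?V" for i j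
    by (rule mpoly.span_base) (auto simp: derivatives_eq)
  have scaleD: "x \<in> ?V" if "const c * x \<in> ?V" "c \<noteq> 0" for c x
    using mpoly.span_scale[OF that(1), of "inverse c"] that(2)
    by (simp add: mpoly.scale_scale)
  have diff: "const (2 * a1 * n) * (var i - var j) \<in> ?V" for i j
  proof -
    obtain k where "k \<noteq> i" "k \<noteq> j" by (rule third_index)
    then show ?thesis
      using mpoly.span_diff[OF D[of k i] D[of k j]] by (simp add: deriv_2 algebra_simps)
  qed
  have var: "var i \<in> ?V" for i
  proof (cases "a1 = 0")
    case True
    obtain k where "k \<noteq> i" by (rule third_index)
    then have "const (6 * a2 * n ^ 2) * var i \<in> ?V"
      using mpoly.span_diff[OF D[of i i] D[of k i]] True by (simp add: deriv_2 algebra_simps)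
    then show ?thesis
      by (rule scaleD) (use True assms n_nonzero in simp)
  next
    case False
    then have diff': "var i - var j \<in> ?V" for j
      using scaleD[OF diff[of i j]] n_nonzero by simp
    \<comment> \<open>Sum of the differences \<open>var i - var j\<close> over all
      \<open>j\<close>.\<close>
    have p: "const n * var i - power_sum 1 \<in> ?V"
    proof -
      have "(\<Sum>j\<in>UNIV. var i - var j) = const n * var i - (power_sum 1 :: ('n, 'k) mpoly)"
        by (simp add: power_sum_def sum_subtractf n_def const_of_nat)
      then show ?thesis using mpoly.span_sum[of UNIV "\<lambda>j. var i - var j"] diff' by metis
    qed
    obtain k where k: "k \<noteq> i" by (rule third_index)
    have 1: "const (2 * n * (3 * a0 + 2 * a1)) * var i \<in> ?V"
    proof -
      have "const (2 * n * (3 * a0 + 2 * a1)) * var i = partial_deriv k (partial_deriv i F)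
          + const (6 * a0) * (const n * var i - power_sum 1) + const (2 * a1 * n) * (var i - var k)"
        using k by (simp add: deriv_2 const_mult const_add algebra_simps)
      then show ?thesis
        by (metis mpoly.span_add mpoly.span_scale D p diff)
    qed
    have 2: "const (2 * n * (3 * a0 + 2 * a1) + 2 * n ^ 2 * (a1 + 3 * a2)) * var i \<in> ?V"
    proof -
      have "const (2 * n * (3 * a0 + 2 * a1) + 2 * n ^ 2 * (a1 + 3 * a2)) * var i =
          partial_deriv i (partial_deriv i F)
          + const (6 * a0 + 2 * a1 * n) * (const n * var i - power_sum 1)"
        by (simp add: deriv_2 const_mult const_add algebra_simps power2_eq_square)
      then show ?thesis
        by (metis mpoly.span_add mpoly.span_scale D p)
    qed
    have 3: "const (2 * n ^ 2 * (a1 + 3 * a2)) * var i \<in> ?V"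
      using mpoly.span_diff[OF 2 1] by (simp add: const_add algebra_simps)
    show ?thesis
      using assms(2) scaleD[OF 1] scaleD[OF 3] n_nonzero by auto
  qed
  have in_span: "var i \<in> mpoly.span (range var)" for i :: 'n
    by (rule mpoly.span_base) simp
  have "partial_deriv j (partial_deriv i F) \<in> mpoly.span (range var)" for i j
    unfolding deriv_2
    by (cases "i = j"; simp only: if_True if_False simp_thms;
        intro mpoly.span_add mpoly.span_scale mpoly.span_zero in_span power_sum_1_in_span)
  then show "mpoly.span (derivatives 2 F) = mpoly.span (range var)"
    using var unfolding mpoly.span_eq by (auto simp: derivatives_eq(2))
qed (rule var_independent)

section \<open>The special points \<P> and \<Q>\<close>

lemma hilbert_at_P:
  assumes "a1 = 0" "a2 = 0"
  shows "hilbert_function F 1 = 1" "hilbert_function F 2 = 1"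
proof -
  have a0: "a0 \<noteq> 0" using assms nonzero by simp
  have d1: "partial_deriv i F = const (3 * a0) * power_sum 1 ^ 2" for i
    by (simp add: deriv_1 assms)
  have d2: "partial_deriv j (partial_deriv i F) = const (6 * a0) * power_sum 1" for i j
    by (simp add: deriv_2 assms)
  have d3: "third_deriv i j k = 6 * a0" for i j k
    unfolding third_deriv_def by (simp add: assms)
  \<comment> \<open>Nonvanishing climbs from the third derivatives, which are the nonzero constant
    \<open>6 * a0\<close>, to the second and then to the first, since the derivative of 0 is
    0.\<close>
  have p1: "const (6 * a0) * power_sum 1 \<noteq> (0 :: ('n, 'k) mpoly)"
    using deriv_3[unfolded d2 d3] a0 by (metis const_eq_0_iff partial_deriv_zero mult_eq_0_iff zero_neq_numeral)
  then have p2: "const (3 * a0) * power_sum 1 ^ 2 \<noteq> (0 :: ('n, 'k) mpoly)"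
    using d2[unfolded d1] by (metis partial_deriv_zero)
  have "derivatives 1 F = {const (3 * a0) * power_sum 1 ^ 2}"
    unfolding derivatives_eq d1 by auto
  then show "hilbert_function F 1 = 1"
    by (intro hilbert_function_eq_1[OF F_nonzero p2]) simp
  have "derivatives 2 F = {const (6 * a0) * power_sum 1}"
    unfolding derivatives_eq d2 by auto
  then show "hilbert_function F 2 = 1"
    by (intro hilbert_function_eq_1[OF F_nonzero p1]) simp
qed

lemma hilbert_at_Q:
  assumes Q: "3 * a0 + 2 * a1 = 0" "a1 + 3 * a2 = 0"
  shows "hilbert_function F 1 = CARD('n) - 1" "hilbert_function F 2 = CARD('n) - 1"
proof -
  have a1: "a1 = - 3 * a2" using Q(2) by (simp add: eq_neg_iff_add_eq_0)
  have "3 * a0 = 3 * (2 * a2)" using Q(1) by (simp add: a1)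
  then have a0: "a0 = 2 * a2" by (metis mult_cancel_left zero_neq_numeral)
  have a2: "a2 \<noteq> 0" using nonzero a0 a1 by auto
  fix i0 :: 'n
  have card_I: "card (UNIV - {i0}) = CARD('n) - 1" by simp
  have "hilbert_function F 1 = card (UNIV - {i0})"
  proof (rule hilbert_function_eq_card[OF F_nonzero finite])
    have "(\<Sum>i\<in>UNIV. partial_deriv i F) = 0" unfolding sum_first_deriv Q by simp
    then show "mpoly.span (derivatives 1 F) = mpoly.span ((\<lambda>i. partial_deriv i F) ` (UNIV - {i0}))"
      unfolding derivatives_eq by (rule span_range_remove)
  next
    fix c i assume c: "(\<Sum>i\<in>UNIV - {i0}. const (c i) * partial_deriv i F) = 0" and i: "i \<in> UNIV - {i0}"
    let ?c = "c(i0 := 0)"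
    have "(\<Sum>i\<in>UNIV. const (?c i) * partial_deriv i F) = (\<Sum>i\<in>UNIV - {i0}. const (c i) * partial_deriv i F)"
      by (intro sum.mono_neutral_cong_right) auto
    \<comment> \<open>Extended by 0 at \<open>i0\<close>, the relation involves all first
      derivatives, so its coefficients are equal; the one at \<open>i0\<close> is 0.\<close>
    then have "?c i = ?c i0"
      by (intro first_deriv_relation_const) (use a2 c in simp_all)
    then show "c i = 0" using i by simp
  qed
  then show "hilbert_function F 1 = CARD('n) - 1" by (simp add: card_I)
  define Y where "Y i = const n * var i - (power_sum 1 :: ('n, 'k) mpoly)" for i
  have "hilbert_function F 2 = card (UNIV - {i0})"
  proof (rule hilbert_function_eq_card[OF F_nonzero finite])
    have "(\<Sum>i\<in>UNIV. Y i) = 0"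
      by (simp add: Y_def sum_subtractf power_sum_def n_def const_of_nat flip: sum_distrib_left)
    then have Y: "mpoly.span (range Y) = mpoly.span (Y ` (UNIV - {i0}))"
      by (rule span_range_remove)
    have D: "partial_deriv j (partial_deriv i F) =
        const (- 6 * a2) * (Y i + Y j) + (if i = j then const (6 * a2 * n) * Y i else 0)" for i j
      by (cases "i = j")
        (simp_all add: deriv_2 Y_def a0 a1 const_mult const_uminus algebra_simps power2_eq_square)
    have Ys: "Y i \<in> mpoly.span (range Y)" for i by (rule mpoly.span_base) simp
    have "partial_deriv j (partial_deriv i F) \<in> mpoly.span (range Y)" for i j
      unfolding D if_distrib[of "\<lambda>x. x \<in> _"]
      by (intro mpoly.span_add mpoly.span_scale Ys) (simp add: mpoly.span_scale mpoly.span_zero Ys)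
    moreover have "Y i \<in> mpoly.span (derivatives 2 F)" for i
    proof -
      \<comment> \<open>The pure second derivative already recovers \<open>Y i\<close>: the scalar
        is \<open>6 * a2 * n\<close> minus twice \<open>6 * a2\<close>.\<close>
      have "partial_deriv i (partial_deriv i F) = const (6 * a2 * (n - 2)) * Y i"
        unfolding D by (simp add: const_mult const_uminus const_diff algebra_simps)
      then have "Y i = const (inverse (6 * a2 * (n - 2))) * partial_deriv i (partial_deriv i F)"
        using a2 n_nonzero by (simp add: mpoly.scale_scale del: inverse_mult_distrib)
      then show ?thesis
        by (metis (mono_tags, lifting) mpoly.span_scale mpoly.span_base derivatives_eq(2) mem_Collect_eq)
    qed
    ultimately have "mpoly.span (derivatives 2 F) = mpoly.span (range Y)"
      unfolding mpoly.span_eq by (auto simp: derivatives_eq(2))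
    then show "mpoly.span (derivatives 2 F) = mpoly.span (Y ` (UNIV - {i0}))" by (simp add: Y)
  next
    fix c i assume c: "(\<Sum>i\<in>UNIV - {i0}. const (c i) * Y i) = 0" and i: "i \<in> UNIV - {i0}"
    let ?c = "c(i0 := 0)"
    let ?s = "\<Sum>i\<in>UNIV. ?c i"
    have "0 = (\<Sum>i\<in>UNIV. const (?c i) * Y i)"
      unfolding c[symmetric] by (intro sum.mono_neutral_cong_left) auto
    also have "\<dots> = (\<Sum>i\<in>UNIV. const (n * ?c i) * var i) - const ?s * power_sum 1"
      by (simp add: Y_def sum_subtractf const_sum const_mult right_diff_distrib sum_distrib_right
          mult.left_commute mult.assoc del: fun_upd_apply)
    also have "\<dots> = (\<Sum>i\<in>UNIV. const (n * ?c i - ?s) * var i)"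
      by (simp add: power_sum_def sum_subtractf left_diff_distrib sum_distrib_left const_diff
          del: fun_upd_apply)
    finally have *: "n * ?c i - ?s = 0" for i
      using var_independent[of "\<lambda>i. n * ?c i - ?s"] by simp
    \<comment> \<open>The extended coefficient at \<open>i0\<close> is 0, so the equation there
      reads \<open>- ?s = 0\<close>.\<close>
    from *[of i0] have "?s = 0" by simp
    with *[of i] show "c i = 0" using i n_nonzero by auto
  qed
  then show "hilbert_function F 2 = CARD('n) - 1" by (simp add: card_I)
qed

end

section \<open>Points of the projective plane and the three cases\<close>

lemma proj_point_eq_iff:
  "proj_point a0 a1 a2 = proj_point b0 b1 b2 \<longleftrightarrow> (\<exists>c. c \<noteq> 0 \<and> a0 = c * b0 \<and> a1 = c * b1 \<and> a2 = c * b2)"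
proof
  assume eq: "proj_point a0 a1 a2 = proj_point b0 b1 b2"
  have "(a0, a1, a2) \<in> proj_point a0 a1 a2"
    unfolding proj_point_def by (auto intro!: exI[of _ 1])
  then show "\<exists>c. c \<noteq> 0 \<and> a0 = c * b0 \<and> a1 = c * b1 \<and> a2 = c * b2"
    unfolding eq by (auto simp: proj_point_def)
next
  assume "\<exists>c. c \<noteq> 0 \<and> a0 = c * b0 \<and> a1 = c * b1 \<and> a2 = c * b2"
  then obtain c where c: "c \<noteq> 0" "a0 = c * b0" "a1 = c * b1" "a2 = c * b2" by blast
  show "proj_point a0 a1 a2 = proj_point b0 b1 b2"
  proof (intro subset_antisym subsetI)
    fix x assume "x \<in> proj_point a0 a1 a2"
    then obtain d where "x = (d * a0, d * a1, d * a2)" "d \<noteq> 0" by (auto simp: proj_point_def)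
    then show "x \<in> proj_point b0 b1 b2"
      using c unfolding proj_point_def by (intro CollectI exI[of _ "d * c"]) (simp add: mult.assoc)
  next
    fix x assume "x \<in> proj_point b0 b1 b2"
    then obtain d where "x = (d * b0, d * b1, d * b2)" "d \<noteq> 0" by (auto simp: proj_point_def)
    then show "x \<in> proj_point a0 a1 a2"
      using c unfolding proj_point_def by (intro CollectI exI[of _ "d / c"]) simp
  qed
qed

lemma proj_point_P_iff:
  assumes "(a0, a1, a2) \<noteq> (0, 0, 0)"
  shows "proj_point a0 a1 a2 = proj_point 1 0 0 \<longleftrightarrow> a1 = 0 \<and> a2 = 0"
  using assms by (auto simp: proj_point_eq_iff)

text \<open>The solutions of the two linear equations are exactly the multiples of
  \<open>(2, -3, 1)\<close>; the scaling factor is \<open>a2\<close>, which cannot be 0 for a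
  nonzero triple.\<close>

lemma proj_point_Q_iff:
  fixes a0 a1 a2 :: "'k::field_char_0"
  assumes "(a0, a1, a2) \<noteq> (0, 0, 0)"
  shows "proj_point a0 a1 a2 = proj_point 2 (-3) 1 \<longleftrightarrow> 3 * a0 + 2 * a1 = 0 \<and> a1 + 3 * a2 = 0"
proof
  assume *: "3 * a0 + 2 * a1 = 0 \<and> a1 + 3 * a2 = 0"
  then have a1: "a1 = - 3 * a2" by (simp add: eq_neg_iff_add_eq_0)
  have "3 * a0 = 3 * (2 * a2)" using * by (simp add: a1)
  then have a0: "a0 = 2 * a2" by (metis mult_cancel_left zero_neq_numeral)
  have "a2 \<noteq> 0" using assms a0 a1 by auto
  then show "proj_point a0 a1 a2 = proj_point 2 (-3) 1"
    using a0 a1 by (auto simp: proj_point_eq_iff intro!: exI[of _ a2])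
qed (auto simp: proj_point_eq_iff)

text \<open>The equation is between functions on all degrees: \<open>nth_default 0\<close> continues
  each list by zeros, which covers the vanishing beyond degree 3.\<close>

theorem proposition4p3:
  fixes a0 a1 a2 :: "'k::field_char_0"
  assumes "CARD('n::finite) \<ge> 3"
    and "(a0, a1, a2) \<noteq> (0, 0, 0)"
  shows "hilbert_function (symmetric_cubic a0 a1 a2 :: ('n, 'k) mpoly) =
    (if proj_point a0 a1 a2 = proj_point 1 0 0 then nth_default 0 [1, 1, 1, 1]
     else if proj_point a0 a1 a2 = proj_point 2 (-3) 1 then
       nth_default 0 [1, CARD('n) - 1, CARD('n) - 1, 1]
     else nth_default 0 [1, CARD('n), CARD('n), 1])"
proof -
  let ?F = "symmetric_cubic a0 a1 a2 :: ('n, 'k) mpoly"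
  interpret cubic_family a0 a1 a2 ?F "of_nat CARD('n)"
    by unfold_locales (use assms in simp_all)
  \<comment> \<open>Only degrees 1 and 2 depend on the point; all other degrees have the same value
    throughout.\<close>
  have *: "hilbert_function ?F = nth_default 0 [1, x, y, 1]"
    if "hilbert_function ?F 1 = x" "hilbert_function ?F 2 = y" for x y
  proof
    fix d :: nat
    consider "d = 0" | "d = 1" | "d = 2" | "d = 3" | "d \<ge> 4" by linarith
    then show "hilbert_function ?F d = nth_default 0 [1, x, y, 1] d"
      using that hilbert_0 hilbert_3 hilbert_ge_4
      by cases (auto simp: nth_default_def nth_Cons')
  qed
  consider (P) "a1 = 0" "a2 = 0"
    | (Q) "a1 \<noteq> 0 \<or> a2 \<noteq> 0" "3 * a0 + 2 * a1 = 0" "a1 + 3 * a2 = 0"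
    | (generic) "a1 \<noteq> 0 \<or> a2 \<noteq> 0" "3 * a0 + 2 * a1 \<noteq> 0 \<or> a1 + 3 * a2 \<noteq> 0"
    by blast
  then show ?thesis
  proof cases
    case P
    then have P': "proj_point a0 a1 a2 = proj_point 1 0 0"
      using proj_point_P_iff[OF assms(2)] by blast
    show ?thesis
      unfolding if_P[OF P'] by (rule *[OF hilbert_at_P[OF P]])
  next
    case Q
    then have P: "proj_point a0 a1 a2 \<noteq> proj_point 1 0 0"
      and Q': "proj_point a0 a1 a2 = proj_point 2 (-3) 1"
      using proj_point_P_iff[OF assms(2)] proj_point_Q_iff[OF assms(2)] by blast+
    show ?thesis
      unfolding if_not_P[OF P] if_P[OF Q'] by (rule *[OF hilbert_at_Q[OF Q(2,3)]])
  next
    case generic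
    then have P: "proj_point a0 a1 a2 \<noteq> proj_point 1 0 0"
      and Q: "proj_point a0 a1 a2 \<noteq> proj_point 2 (-3) 1"
      using proj_point_P_iff[OF assms(2)] proj_point_Q_iff[OF assms(2)] by blast+
    show ?thesis
      unfolding if_not_P[OF P] if_not_P[OF Q]
      by (rule *[OF hilbert_1_generic[OF generic] hilbert_2_generic[OF generic]])
  qed
qed

end
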